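(* Let $\tau\in\mathbb{C}$ with $\operatorname{Im}(\tau)>0$ and $q=e^{2\pi i\tau}$. Then the following ten identities hold: (1) $\displaystyle \frac{\eta(\tau)^2}{\eta(2\tau)}=\sum_{n=-\infty}^{\infty}\left(1-2\left(\frac{n}{2}\right)^2\right)q^{n^2}=\sum_{n=-\infty}^{\infty}(-1)^nq^{n^2}$; (2) $\displaystyle \frac{\eta(\tau)\,\eta(4\tau)\,\eta(6\tau)^2}{\eta(2\tau)\,\eta(3\tau)\,\eta(12\tau)}=\sum_{n=-\infty}^{\infty}\left(1-\frac32\left(\frac{n}{3}\right)^2\right)q^{n^2}$; (3) $\displaystyle \frac{\eta(2\tau)^2\,\eta(3\tau)}{\eta(\tau)\,\eta(6\tau)}=\sum_{n=-\infty}^{\infty}\left(1-2\left(\frac{n}{2}\right)^2-\frac32\left(\frac{n}{3}\right)^2+3\left(\frac{n}{6}\right)^2\right)q^{n^2}$; (4) $\displaystyle \frac{\eta(8\tau)^5}{\eta(4\tau)^2\,\eta(16\tau)^2}=\sum_{n=-\infty}^{\infty}\left(1-\left(\frac{n}{2}\right)^2\right)q^{n^2}$; (5) $\displaystyle \frac{\eta(9\tau)^2}{\eta(18\tau)}=\sum_{n=-\infty}^{\infty}\left(1-2\left(\frac{n}{2}\right)^2-\left(\frac{n}{3}\right)^2+2\left(\frac{n}{6}\right)^2\right)q^{n^2}$; (6) $\displaystyle \frac{\eta(18\tau)^5}{\eta(9\tau)^2\,\eta(36\tau)^2}=\sum_{n=-\infty}^{\infty}\left(1-\left(\frac{n}{3}\right)^2\right)q^{n^2}$;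 (7) $\displaystyle \frac{\eta(4\tau)\,\eta(16\tau)\,\eta(24\tau)^2}{\eta(8\tau)\,\eta(12\tau)\,\eta(48\tau)}=\sum_{n=-\infty}^{\infty}\left(1-\left(\frac{n}{2}\right)^2-\frac32\left(\frac{n}{3}\right)^2+\frac32\left(\frac{n}{6}\right)^2\right)q^{n^2}$; (8) $\displaystyle \frac{\eta(72\tau)^5}{\eta(36\tau)^2\,\eta(144\tau)^2}=\sum_{n=-\infty}^{\infty}\left(1-\left(\frac{n}{2}\right)^2-\left(\frac{n}{3}\right)^2+\left(\frac{n}{6}\right)^2\right)q^{n^2}$; (9) $\displaystyle \frac{\eta(3\tau)\,\eta(18\tau)^2}{\eta(6\tau)\,\eta(9\tau)}=\sum_{n=1}^{\infty}\left(2\left(\frac{n}{6}\right)^2-\left(\frac{n}{3}\right)^2\right)q^{n^2}$; (10) $\displaystyle \frac{\eta(8\tau)^2\,\eta(48\tau)}{\eta(16\tau)\,\eta(24\tau)}=\sum_{n=1}^{\infty}\left(3\left(\frac{n}{6}\right)^2-2\left(\frac{n}{2}\right)^2\right)q^{n^2}$.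
   Context: For $\operatorname{Im}(\tau)>0$ and $q=e^{2\pi i\tau}$, Dedekind's eta function is $\eta(\tau)=q^{1/24}\prod_{n=1}^{\infty}(1-q^n)$, where $q^{1/24}=e^{2\pi i\tau/24}$; $\eta(k\tau)^j$ denotes the $j$-th power of $\eta(k\tau)$. The symbol $\left(\frac{a}{m}\right)$, for an integer $a$ and a positive integer $m$, is the Kronecker symbol: $\left(\frac{a}{1}\right)=1$; for an odd prime $p$, $\left(\frac{a}{p}\right)$ is the Legendre symbol ($0$ if $p\mid a$, $1$ if $a$ is a nonzero quadratic residue mod $p$, $-1$ otherwise); $\left(\frac{a}{2}\right)=0$ if $a$ is even, $1$ if $a\equiv\pm1\pmod 8$, $-1$ if $a\equiv\pm3\pmod 8$; and $\left(\frac{a}{m}\right)=\prod_{i=1}^{s}\left(\frac{a}{p_i}\right)$ if $m=\prod_{i=1}^{s}p_i$ is the factorization of $m$ into primes (with repetition). Thus $\left(\frac{n}{6}\right)=\left(\frac{n}{2}\right)\left(\frac{n}{3}\right)$. *)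

theory Defs
  imports "HOL-Analysis.Analysis" "HOL-Number_Theory.Number_Theory"
begin

text \<open>Meaningful for \<open>Im \<tau> > 0\<close>. The product index starts at 0, hence the exponent \<open>Suc n\<close>.\<close>

definition dedekind_eta :: "complex \<Rightarrow> complex" where
  "dedekind_eta \<tau> =
     exp (2 * of_real pi * \<i> * \<tau> / 24) * (\<Prod>n. 1 - exp (2 * of_real pi * \<i> * \<tau>) ^ Suc n)"

definition kronecker_prime :: "int \<Rightarrow> nat \<Rightarrow> int" where
  "kronecker_prime a p =
     (if p = 2 then (if even a then 0 else if [a = 1] (mod 8) \<or> [a = -1] (mod 8) then 1 else -1)
      else Legendre a (int p))"

text \<open>
  Only the case \<open>m > 0\<close> is intended: the value 1 at \<open>m = 0\<close> is an artefact of
  \<open>prime_factorization 0 = {#}\<close>.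
\<close>

definition kronecker :: "int \<Rightarrow> nat \<Rightarrow> int" where
  "kronecker a m = (\<Prod>p\<in>#prime_factorization m. kronecker_prime a p)"

end

theory Submission
  imports Defs
begin

text \<open>
  Every identity is a specialisation of the Jacobi triple product
  \<open>\<Sum>\<^sub>n x\<^bsup>n\<^sup>2\<^esup> z\<^sup>n = \<Prod>\<^sub>m (1 - x\<^bsup>2m\<^esup>) (1 + x\<^bsup>2m-1\<^esup> z) (1 + x\<^bsup>2m-1\<^esup> / z)\<close>,
  itself the limit of its finite version, whose coefficients are \<open>q\<close>-binomial.
  Only the residue of \<open>n\<close> modulo 6 enters the coefficients. With \<open>\<omega>\<close> a primitive cube root of unity,
  \<open>z = -1\<close> gives (1) and (5), \<open>z = 1\<close> gives (4), (6) and (8), \<open>z = \<omega>\<close> gives (2) and (7),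
  and \<open>z = -\<omega>\<close> gives (3), because \<open>(1 + t \<omega>) (1 + t / \<omega>) = (1 + t\<^sup>3) / (1 + t)\<close> and
  averaging \<open>\<omega>\<^sup>n\<close> over \<open>\<plusminus>n\<close> yields 1 or -1/2 according to whether \<open>3\<close> divides \<open>n\<close>.
  For (9) and (10), the shifts \<open>n = 3 k + 1\<close> and \<open>n = 2 k + 1\<close> lead to
  \<open>x = q\<^sup>9, z = -q\<^sup>6\<close> and \<open>x = q\<^sup>4, z = \<omega> q\<^sup>4\<close>; folding the bilateral series
  along \<open>n \<mapsto> -n\<close> gives the sums over positive \<open>n\<close>.
\<close>

section \<open>Dominated convergence for unordered sums, and summability of theta series\<close>

text \<open>An unordered, absolutely convergent sum over \<open>A\<close> is a Lebesgue integral for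
  the counting measure on \<open>A\<close>, so dominated convergence for integrals transfers. It
  serves to let \<open>N\<close> tend to infinity in the finite triple product.\<close>

lemma has_sum_dominated_convergence:
  fixes f :: "nat \<Rightarrow> 'a \<Rightarrow> complex"
  assumes sums: "\<And>N. (f N has_sum S N) A"
    and lim: "S \<longlonglongrightarrow> L"
    and bound: "\<And>N x. x \<in> A \<Longrightarrow> norm (f N x) \<le> g x"
    and g: "g summable_on A"
    and ptw: "\<And>x. x \<in> A \<Longrightarrow> (\<lambda>N. f N x) \<longlonglongrightarrow> h x"
  shows "(h has_sum L) A"
proof -
  have hbound: "norm (h x) \<le> g x" if "x \<in> A" for x
    by (rule LIMSEQ_le_const2[OF tendsto_norm[OF ptw[OF that]]]) (use bound[OF that] in blast)
  have gA: "Infinite_Sum.abs_summable_on g A"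
    using g by (rule summable_on_iff_abs_summable_on_real[THEN iffD1])
  have absf: "Infinite_Sum.abs_summable_on (f N) A" for N
    by (rule Infinite_Sum.abs_summable_on_comparison_test'[OF g]) (use bound in auto)
  have absh: "Infinite_Sum.abs_summable_on h A"
    by (rule Infinite_Sum.abs_summable_on_comparison_test'[OF g]) (use hbound in auto)
  have "(\<lambda>N. integral\<^sup>L (count_space A) (f N)) \<longlonglongrightarrow> integral\<^sup>L (count_space A) h"
  proof (rule integral_dominated_convergence[where w = g])
    show "integrable (count_space A) g"
      using gA unfolding abs_summable_equivalent by (simp add: Infinite_Set_Sum.abs_summable_on_def)
  qed (use ptw bound in \<open>auto simp: AE_count_space\<close>)
  moreover have "integral\<^sup>L (count_space A) (f N) = S N" for N
    using infsetsum_infsum[of "f N" A] absf[of N] infsumI[OF sums[of N]]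
    unfolding abs_summable_equivalent by (simp add: infsetsum_def)
  moreover have "integral\<^sup>L (count_space A) h = infsum h A"
    using infsetsum_infsum[of h A] absh unfolding abs_summable_equivalent
    by (simp add: infsetsum_def)
  ultimately have "infsum h A = L"
    using lim LIMSEQ_unique by auto
  with absh show ?thesis
    by (metis abs_summable_summable has_sum_infsum)
qed

text \<open>The general term is \<open>(x ^ n * z) ^ n\<close>, and its base tends to 0, so it
  eventually falls below \<open>(1 / 2) ^ n\<close> however large \<open>z\<close> is.\<close>

lemma summable_theta_nat:
  fixes x z :: real
  assumes "0 \<le> x" "x < 1" "0 \<le> z"
  shows "summable (\<lambda>n. x ^ (n ^ 2) * z ^ n)"
proof (rule summable_comparison_test_ev)
  have "(\<lambda>n. x ^ n * z) \<longlonglongrightarrow> 0 * z"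
    using assms by (intro tendsto_intros LIMSEQ_realpow_zero) auto
  then have "eventually (\<lambda>n. x ^ n * z < 1 / 2) sequentially"
    by (rule order_tendstoD) auto
  then show "eventually (\<lambda>n. norm (x ^ (n ^ 2) * z ^ n) \<le> (1 / 2) ^ n) sequentially"
  proof eventually_elim
    case (elim n)
    have "norm (x ^ (n ^ 2) * z ^ n) = (x ^ n * z) ^ n"
      using assms by (simp add: power2_eq_square power_mult power_mult_distrib)
    also have "\<dots> \<le> (1 / 2) ^ n"
      using elim assms by (intro power_mono) auto
    finally show ?case .
  qed
qed auto

lemma summable_on_int:
  fixes f :: "int \<Rightarrow> real"
  assumes "summable (\<lambda>n. norm (f (int n)))" "summable (\<lambda>n. norm (f (- int n)))"
  shows "f summable_on UNIV"
proof -
  have "(f \<circ> int) summable_on UNIV" "(f \<circ> (\<lambda>n. - int n)) summable_on UNIV"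
    using assms by (auto intro!: norm_summable_imp_summable_on simp: o_def)
  then have "f summable_on range int" "f summable_on range (\<lambda>n. - int n)"
    by (subst summable_on_reindex; simp add: inj_def)+
  then have "f summable_on range int \<union> range (\<lambda>n. - int n)"
    by (rule summable_on_union)
  moreover have "range int \<union> range (\<lambda>n. - int n) = UNIV"
    by (auto simp: image_iff) (metis int_cases2)
  ultimately show ?thesis by simp
qed

text \<open>Supplies the dominating series for the limit in \<open>jacobi_triple_product\<close>.
  Negative indices become natural ones on replacing \<open>z\<close> by its inverse, since
  \<open>n ^ 2\<close> is even in \<open>n\<close>.\<close>

lemma summable_on_theta:
  fixes x z :: complex
  assumes "norm x < 1"
  shows "(\<lambda>n. norm (x powi (n ^ 2) * z powi n)) summable_on (UNIV :: int set)"
proof (rule summable_on_int)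
  have *: "norm (x powi (int n ^ 2)) = norm x ^ (n ^ 2)" for n
    by (metis norm_power of_nat_power power_int_of_nat)
  show "summable (\<lambda>n. norm (norm (x powi (int n ^ 2) * z powi (int n))))"
    using summable_theta_nat[of "norm x" "norm z"] assms by (simp add: norm_mult norm_power *)
  show "summable (\<lambda>n. norm (norm (x powi ((- int n) ^ 2) * z powi (- int n))))"
    using summable_theta_nat[of "norm x" "norm (inverse z)"] assms
    by (simp add: norm_mult norm_power norm_inverse power_int_minus power_inverse *)
qed

section \<open>Euler products, their partial products and reciprocals\<close>

text \<open>The q-Pochhammer symbol (w; w) with infinite index: Dedekind eta stripped of its factor
  q^(1/24).\<close>

definition euler_phi :: "complex \<Rightarrow> complex" where
  "euler_phi w = (\<Prod>n. 1 - w ^ Suc n)"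

definition euler_partial :: "complex \<Rightarrow> nat \<Rightarrow> complex" where
  "euler_partial w N = (\<Prod>m<N. 1 - w ^ Suc m)"

lemma one_minus_power_nonzero:
  fixes w :: complex
  assumes "norm w < 1" "n > 0"
  shows "1 - w ^ n \<noteq> 0"
proof
  assume "1 - w ^ n = 0"
  then have "norm (w ^ n) = 1" by simp
  moreover have "norm w ^ n < 1"
    using assms by (simp add: power_less_one_iff)
  ultimately show False by (simp add: norm_power)
qed

lemma one_plus_power_nonzero:
  fixes w :: complex
  assumes "norm w < 1" "n > 0"
  shows "1 + w ^ n \<noteq> 0"
  using one_minus_power_nonzero[OF assms(1), of "2 * n"] assms(2)
  by (auto simp: power_mult power2_eq_square mult.commute[of 2] add_eq_0_iff)

lemma convergent_prod_euler:
  assumes "norm w < 1"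
  shows "convergent_prod (\<lambda>n. 1 - w ^ Suc n :: complex)"
proof -
  have "summable (\<lambda>n. norm w ^ Suc n)"
    using assms by (subst summable_Suc_iff) (simp add: summable_geometric)
  then have "summable (\<lambda>n. norm ((1 - w ^ Suc n) - 1))"
    by (simp add: norm_power norm_mult)
  then show ?thesis
    by (metis abs_convergent_prod_conv_summable abs_convergent_prod_imp_convergent_prod)
qed

lemma euler_phi_nonzero:
  assumes "norm w < 1"
  shows "euler_phi w \<noteq> 0"
  unfolding euler_phi_def
  by (rule prodinf_nonzero[OF convergent_prod_euler[OF assms]])
     (use one_minus_power_nonzero[OF assms] in blast)

lemma euler_partial_nonzero:
  assumes "norm w < 1"
  shows "euler_partial w N \<noteq> 0"
  unfolding euler_partial_def using one_minus_power_nonzero[OF assms]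
  by (metis (no_types, lifting) finite_lessThan prod_zero_iff zero_less_Suc)

lemma euler_partial_LIMSEQ:
  assumes "norm w < 1"
  shows "euler_partial w \<longlonglongrightarrow> euler_phi w"
proof -
  \<comment> \<open>\<open>convergent_prod_LIMSEQ\<close> speaks of products over indices up to and
    including \<open>n\<close>, one factor more than \<open>euler_partial w n\<close>.\<close>
  have "(\<lambda>n. euler_partial w (Suc n)) \<longlonglongrightarrow> euler_phi w"
    using convergent_prod_LIMSEQ[OF convergent_prod_euler[OF assms]]
    by (simp only: euler_partial_def euler_phi_def lessThan_Suc_atMost)
  then show ?thesis by (rule LIMSEQ_imp_Suc)
qed

text \<open>Setting \<open>1 / (w; w)\<^sub>k = 0\<close> for \<open>k < 0\<close> makes the recursion valid for all integers,
  so the boundary terms in the finite triple product need no special treatment.\<close>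
definition euler_recip :: "complex \<Rightarrow> int \<Rightarrow> complex" where
  "euler_recip w k = (if k < 0 then 0 else 1 / euler_partial w (nat k))"

lemma euler_recip_rec:
  assumes "norm w < 1"
  shows "euler_recip w (k - 1) = (1 - w powi k) * euler_recip w k"
proof (cases "k \<le> 0")
  \<comment> \<open>At \<open>k = 0\<close> the factor \<open>1 - w powi 0\<close> vanishes, in
    agreement with the default value 0 at index -1; for \<open>k < 0\<close> both sides are
    defaults.\<close>
  case True
  then show ?thesis by (cases "k = 0") (auto simp: euler_recip_def)
next
  case False
  then obtain j where k: "k = int (Suc j)"
    by (metis not_le pos_int_cases gr0_implies_Suc)
  have "euler_partial w (Suc j) = euler_partial w j * (1 - w ^ Suc j)"
    by (simp add: euler_partial_def)
  moreover have "nat (k - 1) = j" "nat k = Suc j" "w powi k = w ^ Suc j" "\<not> k < 0" "\<not> k - 1 < 0"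
    unfolding k power_int_of_nat by auto
  ultimately show ?thesis
    using one_minus_power_nonzero[OF assms, of "Suc j"]
    by (simp add: euler_recip_def del: power_Suc)
qed

section \<open>The Jacobi triple product, finite and infinite\<close>

text \<open>The algebra behind the passage from \<open>N\<close> to \<open>Suc N\<close> below, to
  be read with \<open>X = x ^ (2*N+1)\<close>, \<open>u = x powi (2*n)\<close>, \<open>v\<close> the
  inverse of \<open>u\<close> and \<open>y\<close> the inverse of \<open>x\<close>. Abstracting
  these powers leaves an identity of rational functions, without integer exponents.\<close>

lemma triple_product_coeff_identity:
  fixes X x y u v :: complex
  assumes "u * v = 1" "x * y = 1"
  shows "(1 - X^2) * (1 - X^2 * x^2) =
    (1 + X^2) * (1 - X * x * v) * (1 - X * x * u)
    + X * (x * v * (1 - X * x * u) * (1 - X * u * y) + x * u * (1 - X * x * v) * (1 - X * v * y))"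
proof -
  have nz: "u \<noteq> 0" "x \<noteq> 0"
    using assms by auto
  then have v: "v = 1 / u" and y: "y = 1 / x"
    using assms by (simp_all add: eq_divide_eq mult.commute)
  show ?thesis
    unfolding v y using nz by (simp add: field_simps power2_eq_square)
qed

text \<open>The assumed identity multiplied through by \<open>P * s * t * w\<close>, with the
  factors grouped as the recursions for the reciprocals leave them in the coefficient step.\<close>

lemma triple_product_coeff_combine:
  fixes P s t w K1 K2 X a1 b1 a2 b2 xv xu :: complex
  assumes "K1 * K2 = (1 + X^2) * a1 * b1 + X * (xv * b1 * b2 + xu * a1 * a2)"
  shows "P * K1 * K2 * s * t * w =
    (1 + X^2) * (P * (a1 * s) * (b1 * t) * w)
    + X * (P * s * (b2 * (b1 * t)) * (w * xv) + P * (a2 * (a1 * s)) * t * (w * xu))"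
proof -
  have "P * K1 * K2 * s * t * w = (K1 * K2) * (P * s * t * w)"
    by (simp only: mult_ac)
  then show ?thesis
    unfolding assms by (simp add: algebra_simps)
qed

text \<open>The coefficient of \<open>z powi n\<close> is \<open>x powi (n^2)\<close> times the
  Gaussian binomial (2N over N+n) in base \<open>x^2\<close>, and vanishes for |n| > N by the
  convention in \<open>euler_recip\<close>. In the induction the new factor
  \<open>(1 + X * z) * (1 + X / z)\<close> expands to \<open>1 + X^2 + X * z + X / z\<close>, which
  gives a three-term recursion for the coefficients.\<close>

lemma finite_triple_product:
  fixes x z :: complex
  assumes x: "norm x < 1" "x \<noteq> 0" and z: "z \<noteq> 0"
  shows "((\<lambda>n. euler_partial (x^2) (2*N) * euler_recip (x^2) (int N - n) * euler_recip (x^2) (int N + n)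
             * x powi (n^2) * z powi n) has_sum
          (\<Prod>m<N. (1 + x ^ (2*m+1) * z) * (1 + x ^ (2*m+1) / z))) (UNIV :: int set)"
proof (induction N)
  case 0
  show ?case
    by (rule has_sum_finite_neutralI[where B = "{0}"])
       (auto simp: euler_recip_def euler_partial_def)
next
  case (Suc N)
  define Q where "Q = x^2"
  have Q: "norm Q < 1" "Q \<noteq> 0"
    using x by (auto simp: Q_def norm_power power_less_one_iff)
  define r where "r = euler_recip Q"
  define P where "P = euler_partial Q"
  define X where "X = x ^ (2*N+1)"
  define c where "c = (\<lambda>N n. P (2*N) * r (int N - n) * r (int N + n) * x powi (n^2))"
  define S where "S = (\<Prod>m<N. (1 + x ^ (2*m+1) * z) * (1 + x ^ (2*m+1) / z))"
  have IH: "((\<lambda>n. c N n * z powi n) has_sum S) UNIV"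
    using Suc by (simp add: c_def P_def r_def Q_def S_def)
  \<comment> \<open>Two shifted copies of the same series, so that the products with
    \<open>z\<close> and \<open>1 / z\<close> can be compared at \<open>z powi n\<close>.\<close>
  have up: "((\<lambda>n. c N (n-1) * z powi (n-1)) has_sum S) UNIV"
    by (subst has_sum_reindex_bij_witness[where i = "\<lambda>n. n + 1" and j = "\<lambda>n. n - 1"])
       (use IH in auto)
  have down: "((\<lambda>n. c N (n+1) * z powi (n+1)) has_sum S) UNIV"
    by (subst has_sum_reindex_bij_witness[where i = "\<lambda>n. n - 1" and j = "\<lambda>n. n + 1"])
       (use IH in auto)
  have tot: "((\<lambda>n. (1 + X^2) * (c N n * z powi n) + (X * z) * (c N (n-1) * z powi (n-1))
           + (X / z) * (c N (n+1) * z powi (n+1))) has_sum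
          ((1 + X^2) * S + (X * z) * S + (X / z) * S)) UNIV"
    by (intro has_sum_add has_sum_cmult_right IH up down)
  have coeff: "c (Suc N) n = (1 + X^2) * c N n + X * (c N (n-1) + c N (n+1))" for n
  proof -
    \<comment> \<open>\<open>a\<close> and \<open>b\<close> are the indices of the reciprocals at
      level \<open>Suc N\<close>. Every index at level \<open>N\<close> is \<open>a\<close> or
      \<open>b\<close> lowered by 0, 1 or 2, so the recursion reduces all terms to
      \<open>r a * r b\<close>.\<close>
    define a where "a = int (Suc N) - n"
    define b where "b = int (Suc N) + n"
    define u where "u = x powi (2*n)"
    define v where "v = x powi (-2*n)"
    define y where "y = inverse x"
    have uv: "u * v = 1" "x * y = 1"
      using x by (auto simp: u_def v_def y_def power_int_minus)
    have Xp: "X = x powi (2 * int N + 1)"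
      using power_int_of_nat[of x "2*N+1"] by (simp add: X_def add.commute)
    have Qp: "Q powi k = x powi (2 * k)" for k
      by (simp add: Q_def power_int_mult)
    have y': "y = x powi (-1)" by (simp add: y_def power_int_minus)
    have mult_y: "x powi k * x powi (-1) = x powi (k - 1)" for k
      using x(2) by (simp add: power_int_diff power_int_minus divide_inverse)
    have Qa: "Q powi a = X * x * v" "Q powi b = X * x * u"
       "Q powi (a - 1) = X * (v * y)" "Q powi (b - 1) = X * (u * y)"
      unfolding Qp Xp u_def v_def y' a_def b_def mult_y
      by (simp_all add: x(2) algebra_simps flip: power_int_add power_int_add_1 power_int_add_1')
    have PS: "P (2 * Suc N) = P (2 * N) * (1 - X^2) * (1 - X^2 * x^2)"
    proof -
      have "Q ^ Suc (2*N) = X^2" "Q ^ Suc (Suc (2*N)) = X^2 * x^2"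
        by (simp_all add: X_def Q_def power_mult_distrib power2_eq_square power_add power_mult mult_ac)
      then show ?thesis
        by (simp add: P_def euler_partial_def del: power_Suc)
    qed
    have ra: "r (a - 1) = (1 - X * x * v) * r a" "r (b - 1) = (1 - X * x * u) * r b"
      "r (a - 2) = (1 - X * v * y) * r (a - 1)" "r (b - 2) = (1 - X * u * y) * r (b - 1)"
      using euler_recip_rec[OF Q(1), of a] euler_recip_rec[OF Q(1), of b]
         euler_recip_rec[OF Q(1), of "a-1"] euler_recip_rec[OF Q(1), of "b-1"]
      by (simp_all add: r_def Qa mult.assoc)
    have sq: "x powi ((n-1)^2) = x powi (n^2) * (x * v)" "x powi ((n+1)^2) = x powi (n^2) * (x * u)"
      unfolding u_def v_def
      by (simp_all add: x(2) power2_eq_square algebra_simps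
            flip: power_int_add power_int_add_1 power_int_add_1')
    have c1: "c (Suc N) n = P (2 * Suc N) * r a * r b * x powi (n^2)"
      by (simp add: c_def a_def b_def)
    have c2: "c N n = P (2*N) * r (a-1) * r (b-1) * x powi (n^2)"
      by (simp add: c_def a_def b_def)
    have c3: "c N (n-1) = P (2*N) * r a * r (b-2) * x powi ((n-1)^2)"
      by (simp add: c_def a_def b_def algebra_simps)
    have c4: "c N (n+1) = P (2*N) * r (a-2) * r b * x powi ((n+1)^2)"
      by (simp add: c_def a_def b_def algebra_simps)
    show ?thesis
      unfolding c1 c2 c3 c4 PS ra sq
      using triple_product_coeff_identity[OF uv, of X] by (rule triple_product_coeff_combine)
  qed
  have "(1 + X^2) * (c N n * z powi n) + (X * z) * (c N (n-1) * z powi (n-1))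
           + (X / z) * (c N (n+1) * z powi (n+1)) = c (Suc N) n * z powi n" for n
  proof -
    define p where "p = z powi (n-1)"
    have zn: "z powi n = p * z" "z powi (n+1) = p * z * z"
      using z by (simp_all add: p_def power_int_minus_mult power_int_add_1)
    show ?thesis
      unfolding coeff zn p_def[symmetric] using z by (simp add: algebra_simps)
  qed
  moreover have "(1 + X^2) * S + (X * z) * S + (X / z) * S = S * ((1 + X * z) * (1 + X / z))"
    using z by (simp add: field_simps power2_eq_square)
  ultimately have "((\<lambda>n. c (Suc N) n * z powi n) has_sum (S * ((1 + X * z) * (1 + X / z)))) UNIV"
    using tot by (simp only:)
  then show ?case
    by (simp only: c_def P_def r_def Q_def S_def X_def prod.lessThan_Suc)
qed

text \<open>For fixed \<open>n\<close> the finite coefficient tends to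
  \<open>1 / euler_phi (x^2)\<close> times the theta term: the numerator contributes one factor
  \<open>euler_phi (x^2)\<close>, the two reciprocals remove two. All three are bounded uniformly in
  \<open>N\<close>, so a multiple of the theta series dominates. The limit \<open>L\<close> is left
  open so that each application can supply its own closed form.\<close>

theorem jacobi_triple_product:
  fixes x z :: complex
  assumes x: "norm x < 1" "x \<noteq> 0" and z: "z \<noteq> 0"
    and L: "(\<lambda>N. \<Prod>m<N. (1 + x ^ (2*m+1) * z) * (1 + x ^ (2*m+1) / z)) \<longlonglongrightarrow> L"
  shows "((\<lambda>n. x powi (n^2) * z powi n) has_sum (euler_phi (x^2) * L)) (UNIV :: int set)"
proof -
  define Q where "Q = x^2"
  have Q: "norm Q < 1"
    using x by (auto simp: Q_def norm_power power_less_one_iff)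
  note lim = euler_partial_LIMSEQ[OF Q] and nz = euler_phi_nonzero[OF Q]
  obtain B where B: "norm (euler_partial Q n) \<le> B" for n
    using convergent_imp_Bseq[OF convergentI[OF lim]] by (auto simp: Bseq_def)
  have lim': "(\<lambda>n. 1 / euler_partial Q n) \<longlonglongrightarrow> 1 / euler_phi Q"
    by (intro tendsto_intros lim nz)
  then obtain C where C: "norm (1 / euler_partial Q n) \<le> C" for n
    using convergent_imp_Bseq[OF convergentI[OF lim']] by (auto simp: Bseq_def)
  have B0: "0 \<le> B" using norm_ge_zero B by (rule order_trans)
  have C0: "0 \<le> C" using norm_ge_zero C by (rule order_trans)
  have C': "norm (euler_recip Q k) \<le> C" for k
    using C C0 by (auto simp: euler_recip_def)
  \<comment> \<open>For small \<open>N\<close> the index \<open>int N + k\<close> may be negative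
    and hit the default value 0, so the two sequences agree only eventually.\<close>
  have shift: "(\<lambda>N. euler_recip Q (int N + k)) \<longlonglongrightarrow> 1 / euler_phi Q" for k
  proof -
    have "filterlim (\<lambda>N. nat (int N + k)) at_top sequentially"
      unfolding filterlim_at_top
    proof
      fix M show "eventually (\<lambda>N. M \<le> nat (int N + k)) sequentially"
        using eventually_ge_at_top[of "M + nat \<bar>k\<bar>"] by eventually_elim linarith
    qed
    then have "(\<lambda>N. 1 / euler_partial Q (nat (int N + k))) \<longlonglongrightarrow> 1 / euler_phi Q"
      by (rule filterlim_compose[OF lim'])
    moreover have "eventually (\<lambda>N. 1 / euler_partial Q (nat (int N + k)) = euler_recip Q (int N + k)) sequentially"
      using eventually_ge_at_top[of "nat \<bar>k\<bar>"] by eventually_elim (auto simp: euler_recip_def)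
    ultimately show ?thesis
      by (rule Lim_transform_eventually)
  qed
  have lim2: "(\<lambda>N. euler_partial Q (2 * N)) \<longlonglongrightarrow> euler_phi Q"
    using lim by (rule filterlim_compose) (simp add: mult_nat_left_at_top)
  define t where "t = (\<lambda>n :: int. x powi (n^2) * z powi n)"
  have "((\<lambda>n. t n / euler_phi Q) has_sum L) UNIV"
  proof (rule has_sum_dominated_convergence[OF _ L])
    fix N
    show "((\<lambda>n. euler_partial Q (2*N) * euler_recip Q (int N - n) * euler_recip Q (int N + n) * t n)
       has_sum (\<Prod>m<N. (1 + x ^ (2*m+1) * z) * (1 + x ^ (2*m+1) / z))) UNIV"
      using finite_triple_product[OF x z, of N] by (simp add: Q_def t_def mult_ac)
    fix n :: int
    have "norm (euler_partial Q (2*N) * euler_recip Q (int N - n) * euler_recip Q (int N + n) * t n)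
        \<le> B * C * C * norm (t n)"
      unfolding norm_mult using B0 C0 by (intro mult_mono B C' mult_nonneg_nonneg) auto
    then show "norm (euler_partial Q (2*N) * euler_recip Q (int N - n) * euler_recip Q (int N + n) * t n)
        \<le> (B * C * C) * norm (t n)" .
  next
    show "(\<lambda>n. (B * C * C) * norm (t n)) summable_on UNIV"
      unfolding t_def by (intro summable_on_cmult_right summable_on_theta x)
  next
    fix n :: int
    have "(\<lambda>N. euler_partial Q (2*N) * euler_recip Q (int N + (-n)) * euler_recip Q (int N + n) * t n)
       \<longlonglongrightarrow> euler_phi Q * (1 / euler_phi Q) * (1 / euler_phi Q) * t n"
      by (intro tendsto_intros lim2 shift)
    then show "(\<lambda>N. euler_partial Q (2*N) * euler_recip Q (int N - n) * euler_recip Q (int N + n) * t n)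
       \<longlonglongrightarrow> t n / euler_phi Q"
      using nz by simp
  qed
  from has_sum_cmult_right[OF this, of "euler_phi Q"] show ?thesis
    using nz by (simp add: t_def Q_def)
qed

section \<open>Closed forms for products over odd or all exponents\<close>

text \<open>Splitting the first 2N factors of the Euler product by parity of the exponent leaves the
  odd part times \<open>euler_partial (w^2) N\<close>.\<close>

lemma prod_odd_minus_LIMSEQ:
  fixes w :: complex
  assumes "norm w < 1"
  shows "(\<lambda>N. \<Prod>m<N. 1 - w ^ (2*m+1)) \<longlonglongrightarrow> euler_phi w / euler_phi (w^2)"
proof -
  have w2: "norm (w^2) < 1"
    using assms by (simp add: norm_power power_less_one_iff)
  have "(\<Prod>m<N. 1 - w ^ (2*m+1)) * euler_partial (w^2) N = euler_partial w (2*N)" for N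
  proof (induction N)
    case (Suc N)
    have w: "(w^2) ^ Suc N = w ^ Suc (Suc (2*N))" and N: "2 * Suc N = Suc (Suc (2*N))" "2*N+1 = Suc (2*N)"
      by (simp_all only: flip: power_mult) simp_all
    have "(\<Prod>m<Suc N. 1 - w ^ (2*m+1)) * euler_partial (w^2) (Suc N) =
      ((\<Prod>m<N. 1 - w ^ (2*m+1)) * euler_partial (w^2) N) * (1 - w ^ Suc (2*N)) * (1 - w ^ Suc (Suc (2*N)))"
      by (simp only: euler_partial_def prod.lessThan_Suc w N) (simp only: mult_ac)
    then show ?case
      by (simp only: Suc N) (simp only: euler_partial_def prod.lessThan_Suc)
  qed (simp add: euler_partial_def)
  then have eq: "(\<Prod>m<N. 1 - w ^ (2*m+1)) = euler_partial w (2*N) / euler_partial (w^2) N" for N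
    using euler_partial_nonzero[OF w2, of N] by (simp add: field_simps)
  have "(\<lambda>N. euler_partial w (2*N)) \<longlonglongrightarrow> euler_phi w"
    using euler_partial_LIMSEQ[OF assms] by (rule filterlim_compose) (simp add: mult_nat_left_at_top)
  then show ?thesis
    unfolding eq by (intro tendsto_intros euler_partial_LIMSEQ euler_phi_nonzero w2)
qed

text \<open>Closed form of the product of \<open>1 + w ^ (2*m+1)\<close> over all \<open>m\<close>,
  as \<open>prod_odd_plus_LIMSEQ\<close> confirms; in this form it reads off as an eta
  quotient.\<close>

definition odd_plus_prod :: "complex \<Rightarrow> complex" where
  "odd_plus_prod w = euler_phi (w^2) ^ 2 / (euler_phi w * euler_phi (w^4))"

lemma odd_plus_prod_nonzero:
  assumes "norm w < 1"
  shows "odd_plus_prod w \<noteq> 0"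
  using assms by (simp add: odd_plus_prod_def euler_phi_nonzero norm_power power_less_one_iff)

text \<open>Factorwise 1 + t = (1 - t^2) / (1 - t), so this is a quotient of two odd products, with
  bases \<open>w^2\<close> and \<open>w\<close>.\<close>

lemma prod_odd_plus_LIMSEQ:
  fixes w :: complex
  assumes "norm w < 1"
  shows "(\<lambda>N. \<Prod>m<N. 1 + w ^ (2*m+1)) \<longlonglongrightarrow> odd_plus_prod w"
proof -
  have w2: "norm (w^2) < 1" and w4: "norm ((w^2)^2) < 1"
    using assms by (simp_all add: norm_power power_less_one_iff)
  have "1 + w ^ (2*m+1) = (1 - (w^2) ^ (2*m+1)) / (1 - w ^ (2*m+1))" for m
    using one_minus_power_nonzero[OF assms, of "2*m+1"]
    by (simp add: eq_divide_eq algebra_simps power2_eq_square power_mult_distrib del: power_Suc)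
  then have eq: "(\<Prod>m<N. 1 + w ^ (2*m+1)) = (\<Prod>m<N. 1 - (w^2) ^ (2*m+1)) / (\<Prod>m<N. 1 - w ^ (2*m+1))" for N
    by (simp only: prod_dividef)
  have "odd_plus_prod w = (euler_phi (w^2) / euler_phi ((w^2)^2)) / (euler_phi w / euler_phi (w^2))"
    by (simp add: odd_plus_prod_def power2_eq_square[of "euler_phi (w^2)"] flip: power_mult)
  moreover have "euler_phi w / euler_phi (w^2) \<noteq> 0"
    using euler_phi_nonzero[OF assms] euler_phi_nonzero[OF w2] by simp
  note tendsto_divide[OF prod_odd_minus_LIMSEQ[OF w2] prod_odd_minus_LIMSEQ[OF assms] this]
  ultimately show ?thesis
    unfolding eq by (simp only:)
qed

lemma prod_plus_LIMSEQ:
  fixes w :: complex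
  assumes "norm w < 1"
  shows "(\<lambda>N. \<Prod>m<N. 1 + w ^ Suc m) \<longlonglongrightarrow> euler_phi (w^2) / euler_phi w"
proof -
  have w2: "norm (w^2) < 1"
    using assms by (simp add: norm_power power_less_one_iff)
  have "1 + w ^ Suc m = (1 - (w^2) ^ Suc m) / (1 - w ^ Suc m)" for m
    using one_minus_power_nonzero[OF assms, of "Suc m"]
    by (simp add: eq_divide_eq algebra_simps power2_eq_square power_mult_distrib)
  then have eq: "(\<Prod>m<N. 1 + w ^ Suc m) = euler_partial (w^2) N / euler_partial w N" for N
    by (simp only: prod_dividef euler_partial_def)
  show ?thesis
    unfolding eq by (intro tendsto_intros euler_partial_LIMSEQ euler_phi_nonzero assms w2)
qed

section \<open>Primitive cube roots of unity\<close>

lemma cube_root_unity_facts: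
  fixes \<omega> :: complex
  assumes "\<omega>^2 + \<omega> + 1 = 0"
  shows "\<omega> \<noteq> 0" "\<omega>^3 = 1" "1 / \<omega> = \<omega>^2" "\<omega>^2 = -1 - \<omega>"
proof -
  show "\<omega> \<noteq> 0" using assms by auto
  show sq: "\<omega>^2 = -1 - \<omega>"
    using assms by (metis add.assoc add_eq_0_iff diff_minus_eq_add minus_add_distrib add.commute uminus_add_conv_diff)
  have "\<omega>^3 = \<omega> * \<omega>^2" by (simp add: power2_eq_square power3_eq_cube)
  also have "\<dots> = - (\<omega>^2) - \<omega>" unfolding sq by (simp add: algebra_simps sq[unfolded power2_eq_square])
  finally show cube: "\<omega>^3 = 1" unfolding sq by simp
  show "1 / \<omega> = \<omega>^2"
    using cube \<open>\<omega> \<noteq> 0\<close> by (simp add: field_simps power2_eq_square power3_eq_cube)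
qed

text \<open>Expand and use that \<open>\<omega> + \<omega>^2\<close> is -1 and
  \<open>\<omega>^3\<close> is 1. A further factor \<open>1 + t\<close> turns the right side into
  \<open>1 + t^3\<close>, which removes \<open>\<omega>\<close> from the products below.\<close>

lemma cube_root_unity_factor:
  fixes \<omega> t :: complex
  assumes "\<omega>^2 + \<omega> + 1 = 0"
  shows "(1 + t * \<omega>) * (1 + t * \<omega>^2) = 1 - t + t^2"
proof -
  have "(1 + t * \<omega>) * (1 + t * \<omega>^2) = 1 + t * (\<omega> + \<omega>^2) + t^2 * \<omega>^3"
    by (simp add: algebra_simps power2_eq_square power3_eq_cube)
  also have "\<omega> + \<omega>^2 = -1"
    using cube_root_unity_facts(4)[OF assms] by simp
  finally show ?thesis
    using cube_root_unity_facts(2)[OF assms] by simp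
qed

lemma cube_root_unity_exists: "\<exists>\<omega>::complex. \<omega>^2 + \<omega> + 1 = 0"
proof
  show "(Complex (-1/2) (sqrt 3 / 2))^2 + Complex (-1/2) (sqrt 3 / 2) + 1 = 0"
    by (simp add: complex_eq_iff power2_eq_square field_simps)
qed

text \<open>Exponents matter only modulo 3, so three residues remain to be checked. Half of these
  values are 1 and 1 - 3/2, the source of the coefficient 3/2 in the identities.\<close>

lemma cube_root_unity_powi_sum:
  fixes \<omega> :: complex and n :: int
  assumes "\<omega>^2 + \<omega> + 1 = 0"
  shows "\<omega> powi n + \<omega> powi (-n) = (if 3 dvd n then 2 else -1)"
proof -
  note w = cube_root_unity_facts[OF assms]
  have per: "\<omega> powi (3 * k + r) = \<omega> powi r" for k r
    using w by (simp add: power_int_add power_int_mult)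
  have inv: "inverse \<omega> = \<omega>^2" "inverse (\<omega>^2) = \<omega>"
    using w(3) by (simp_all add: inverse_eq_divide) (metis divide_divide_eq_right div_by_1 mult_1 w(3))
  have sum: "\<omega> + \<omega>^2 = -1" using w(4) by simp
  define k where "k = n div 3"
  have "n mod 3 = 0 \<or> n mod 3 = 1 \<or> n mod 3 = 2" by presburger
  then consider "n = 3 * k + 0" | "n = 3 * k + 1" | "n = 3 * k + 2"
    unfolding k_def by (metis mult_div_mod_eq)
  then show ?thesis
  proof cases
    case 1
    then show ?thesis using per[of k 0] per[of "-k" 0] by simp
  next
    case 2
    then have "- n = 3 * (-k) + (-1)" "\<not> 3 dvd n" by presburger+
    then show ?thesis using 2 per[of k 1] per[of "-k" "-1"] sum
      by (simp add: power_int_minus inv)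
  next
    case 3
    then have "- n = 3 * (-k) + (-2)" "\<not> 3 dvd n" by presburger+
    then show ?thesis using 3 per[of k 2] per[of "-k" "-2"] sum
      by (simp add: power_int_minus inv add.commute)
  qed
qed

section \<open>Folding and reindexing bilateral series\<close>

lemma has_sum_symmetrize:
  fixes f :: "int \<Rightarrow> complex"
  assumes "(f has_sum S) UNIV"
  shows "((\<lambda>n. f n + f (-n)) has_sum (2 * S)) UNIV"
proof -
  have "((\<lambda>n. f (-n)) has_sum S) UNIV"
    by (subst has_sum_reindex_bij_witness[where i = uminus and j = uminus]) (use assms in auto)
  from has_sum_add[OF assms this] show ?thesis by simp
qed

text \<open>Negation carries the negative half of the index set onto the positive half, and index 0
  contributes nothing; so the folded sum keeps the total \<open>S\<close>.\<close>

lemma has_sum_symmetrize_positive: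
  fixes f :: "int \<Rightarrow> complex"
  assumes f: "(f has_sum S) UNIV" and f0: "f 0 = 0"
  shows "((\<lambda>n. f n + f (-n)) has_sum S) {1..}"
proof -
  have "f summable_on {1..}" "f summable_on {..-1}"
    using has_sum_imp_summable[OF f] summable_on_subset by blast+
  then obtain T U where T: "(f has_sum T) {1..}" and U: "(f has_sum U) {..-1}"
    by (auto simp: summable_on_def)
  have "((\<lambda>n. f (-n)) has_sum U) {1..}"
    by (subst has_sum_reindex_bij_witness[where i = uminus and j = uminus and T = "{..-1}" and h = f and s' = U])
       (use U in auto)
  from has_sum_add[OF T this] have "((\<lambda>n. f n + f (-n)) has_sum (T + U)) {1..}" .
  moreover have "(f has_sum (T + U)) ({1..} \<union> {..-1})"
    by (intro has_sum_Un_disjoint T U) auto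
  then have "(f has_sum (T + U)) UNIV"
  proof (rule has_sum_cong_neutral[THEN iffD1, rotated -1])
    fix n :: int assume "n \<in> UNIV - ({1..} \<union> {..-1})"
    then have "n = 0" by auto
    then show "f n = 0" using f0 by simp
  qed auto
  then have "T + U = S"
    using f has_sum_unique by blast
  ultimately show ?thesis by simp
qed

text \<open>Off the residue class of \<open>r\<close> modulo \<open>k\<close> all terms vanish. It
  is applied with \<open>r = 0\<close> to identities living on multiples of 2, 3 or 6, and with
  \<open>r = 1\<close> to the two one-sided ones.\<close>

lemma has_sum_affine_support:
  fixes g :: "int \<Rightarrow> complex"
  assumes "((\<lambda>n. g (k * n + r)) has_sum S) UNIV" "k \<noteq> 0"
    and "\<And>n. \<not> k dvd n - r \<Longrightarrow> g n = 0"
  shows "(g has_sum S) UNIV"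
proof -
  have "(g has_sum S) (range (\<lambda>n. k * n + r))"
    using assms(1,2) by (subst has_sum_reindex) (auto simp: inj_def o_def)
  then show ?thesis
  proof (rule has_sum_cong_neutral[THEN iffD1, rotated -1])
    fix n assume "n \<in> UNIV - range (\<lambda>n. k * n + r)"
    then have "\<not> k dvd n - r"
      by (auto simp: image_iff dvd_def) (metis diff_add_cancel)
    then show "g n = 0" by (rule assms(3))
  qed auto
qed

section \<open>Specialised theta series\<close>

lemma theta_plus:
  assumes x: "norm x < 1" "x \<noteq> 0"
  shows "((\<lambda>n. x powi (n^2)) has_sum (euler_phi (x^2) * odd_plus_prod x ^ 2)) (UNIV :: int set)"
proof -
  have "(\<lambda>N. (\<Prod>m<N. (1 + x ^ (2*m+1))) * (\<Prod>m<N. (1 + x ^ (2*m+1)))) \<longlonglongrightarrow> odd_plus_prod x * odd_plus_prod x"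
    by (intro tendsto_mult prod_odd_plus_LIMSEQ x)
  then show ?thesis
    using jacobi_triple_product[OF x, of 1 "odd_plus_prod x ^ 2"]
    by (simp add: prod.distrib power2_eq_square)
qed

lemma theta_minus:
  assumes x: "norm x < 1" "x \<noteq> 0"
  shows "((\<lambda>n. (-1) powi n * x powi (n^2)) has_sum (euler_phi x ^ 2 / euler_phi (x^2))) (UNIV :: int set)"
proof -
  define p where "p = euler_phi x / euler_phi (x^2)"
  have "(\<lambda>N. (\<Prod>m<N. (1 - x ^ (2*m+1))) * (\<Prod>m<N. (1 - x ^ (2*m+1)))) \<longlonglongrightarrow> p * p"
    unfolding p_def by (intro tendsto_mult prod_odd_minus_LIMSEQ x)
  then have "((\<lambda>n. (-1) powi n * x powi (n^2)) has_sum (euler_phi (x^2) * p^2)) UNIV"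
    using jacobi_triple_product[OF x, of "-1" "p^2"]
    by (simp add: prod.distrib power2_eq_square mult.commute)
  also have "euler_phi (x^2) * p^2 = euler_phi x ^ 2 / euler_phi (x^2)"
  proof -
    have "euler_phi (x^2) \<noteq> 0"
      using x by (intro euler_phi_nonzero) (simp add: norm_power power_less_one_iff)
    then show ?thesis
      by (simp add: p_def power2_eq_square[of "euler_phi _"] power2_eq_square[of "_ / _"])
  qed
  finally show ?thesis .
qed

lemma theta_cubic:
  assumes x: "norm x < 1" "x \<noteq> 0"
  shows "((\<lambda>n. (if 3 dvd n then 1 else -1/2) * x powi (n^2)) has_sum
     (euler_phi (x^2) * (odd_plus_prod (x^3) / odd_plus_prod x))) (UNIV :: int set)"
proof -
  obtain \<omega> :: complex where om: "\<omega>^2 + \<omega> + 1 = 0" using cube_root_unity_exists by blast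
  note w = cube_root_unity_facts[OF om]
  define S where "S = euler_phi (x^2) * (odd_plus_prod (x^3) / odd_plus_prod x)"
  have x3: "norm (x^3) < 1"
    using x by (simp add: norm_power power_less_one_iff)
  have fac: "(1 + x ^ (2*m+1) * \<omega>) * (1 + x ^ (2*m+1) / \<omega>) = (1 + (x^3) ^ (2*m+1)) / (1 + x ^ (2*m+1))" for m
  proof -
    define t where "t = x ^ (2*m+1)"
    have t3: "(x^3) ^ (2*m+1) = t^3" by (simp only: t_def mult.commute flip: power_mult)
    have "1 + t \<noteq> 0" using one_plus_power_nonzero[OF x(1), of "2*m+1"] by (simp add: t_def)
    moreover have "t / \<omega> = t * \<omega>^2" using w(3) by (metis times_divide_eq_right mult.right_neutral)
    moreover have "(1 + t * \<omega>) * (1 + t * \<omega>^2) * (1 + t) = 1 + t^3"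
      unfolding cube_root_unity_factor[OF om] by (simp add: algebra_simps power2_eq_square power3_eq_cube)
    ultimately show ?thesis
      unfolding t3 t_def[symmetric] by (simp add: field_simps)
  qed
  have "(\<lambda>N. \<Prod>m<N. (1 + x ^ (2*m+1) * \<omega>) * (1 + x ^ (2*m+1) / \<omega>)) \<longlonglongrightarrow> odd_plus_prod (x^3) / odd_plus_prod x"
    unfolding fac prod_dividef
    by (intro tendsto_divide prod_odd_plus_LIMSEQ odd_plus_prod_nonzero x x3)
  from jacobi_triple_product[OF x w(1) this]
  have "((\<lambda>n. x powi (n^2) * \<omega> powi n) has_sum S) UNIV" by (simp add: S_def)
  \<comment> \<open>Indices \<open>n\<close> and \<open>-n\<close> carry the same power of
    \<open>x\<close>, so averaging them replaces \<open>\<omega> powi n\<close> by 1 or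
    -1/2.\<close>
  from has_sum_cmult_right[OF has_sum_symmetrize[OF this], of "1/2"]
  have "((\<lambda>n. 1/2 * (x powi (n^2) * \<omega> powi n + x powi (n^2) * \<omega> powi (-n))) has_sum S) UNIV" by simp
  moreover have "1/2 * (x powi (n^2) * \<omega> powi n + x powi (n^2) * \<omega> powi (-n))
      = (if 3 dvd n then 1 else -1/2) * x powi (n^2)" for n
    unfolding distrib_left[symmetric] cube_root_unity_powi_sum[OF om] by simp
  ultimately show ?thesis by (simp add: S_def)
qed

lemma theta_cubic_alternating:
  assumes x: "norm x < 1" "x \<noteq> 0"
  shows "((\<lambda>n. (-1) powi n * (if 3 dvd n then 1 else -1/2) * x powi (n^2)) has_sum
     (euler_phi (x^2) * ((euler_phi (x^3) / euler_phi (x^6)) / (euler_phi x / euler_phi (x^2))))) (UNIV :: int set)"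
proof -
  obtain \<omega> :: complex where om: "\<omega>^2 + \<omega> + 1 = 0" using cube_root_unity_exists by blast
  note w = cube_root_unity_facts[OF om]
  define S where "S = euler_phi (x^2) * ((euler_phi (x^3) / euler_phi (x^6)) / (euler_phi x / euler_phi (x^2)))"
  have x23: "norm (x^3) < 1" "norm (x^2) < 1"
    using x by (simp_all add: norm_power power_less_one_iff)
  have fac: "(1 + x ^ (2*m+1) * (-\<omega>)) * (1 + x ^ (2*m+1) / (-\<omega>)) = (1 - (x^3) ^ (2*m+1)) / (1 - x ^ (2*m+1))" for m
  proof -
    define t where "t = x ^ (2*m+1)"
    have t3: "(x^3) ^ (2*m+1) = t^3" by (simp only: t_def mult.commute flip: power_mult)
    have "1 - t \<noteq> 0" using one_minus_power_nonzero[OF x(1), of "2*m+1"] by (simp add: t_def)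
    moreover have "t / (-\<omega>) = -(t * \<omega>^2)" using w(3) by (metis times_divide_eq_right mult.right_neutral divide_minus_right)
    moreover have "(1 + t * (-\<omega>)) * (1 + - (t * \<omega>^2)) * (1 - t) = 1 - t^3"
      using cube_root_unity_factor[OF om, of "-t"]
      by (simp add: algebra_simps power2_eq_square power3_eq_cube)
    ultimately show ?thesis
      unfolding t3 t_def[symmetric] by (simp add: field_simps)
  qed
  have "(\<lambda>N. \<Prod>m<N. (1 + x ^ (2*m+1) * (-\<omega>)) * (1 + x ^ (2*m+1) / (-\<omega>)))
      \<longlonglongrightarrow> (euler_phi (x^3) / euler_phi ((x^3)^2)) / (euler_phi x / euler_phi (x^2))"
    unfolding fac prod_dividef
    using euler_phi_nonzero[OF x(1)] euler_phi_nonzero[OF x23(2)]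
    by (intro tendsto_divide prod_odd_minus_LIMSEQ x x23) auto
  from jacobi_triple_product[OF x _ this] w(1)
  have "((\<lambda>n. x powi (n^2) * (-\<omega>) powi n) has_sum S) UNIV" by (simp add: S_def flip: power_mult)
  from has_sum_cmult_right[OF has_sum_symmetrize[OF this], of "1/2"]
  have "((\<lambda>n. 1/2 * (x powi (n^2) * (-\<omega>) powi n + x powi (n^2) * (-\<omega>) powi (-n))) has_sum S) UNIV" by simp
  moreover have "1/2 * (x powi (n^2) * (-\<omega>) powi n + x powi (n^2) * (-\<omega>) powi (-n))
      = (-1) powi n * (if 3 dvd n then 1 else -1/2) * x powi (n^2)" for n
  proof -
    \<comment> \<open>The sign is the same at \<open>n\<close> and \<open>-n\<close>, hence it
      factors out of the average.\<close>
    have "(-\<omega>) powi n = (-1) powi n * \<omega> powi n" "(-\<omega>) powi (-n) = (-1) powi n * \<omega> powi (-n)"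
      using power_int_mult_distrib[of "-1" \<omega> n] power_int_mult_distrib[of "-1" \<omega> "-n"]
      by (simp_all add: power_int_minus flip: power_int_inverse)
    then have "1/2 * (x powi (n^2) * (-\<omega>) powi n + x powi (n^2) * (-\<omega>) powi (-n))
       = 1/2 * (x powi (n^2) * ((-1) powi n * (\<omega> powi n + \<omega> powi (-n))))"
      by (simp add: algebra_simps)
    also have "\<dots> = (-1) powi n * (if 3 dvd n then 1 else -1/2) * x powi (n^2)"
      unfolding cube_root_unity_powi_sum[OF om] by simp
    finally show ?thesis .
  qed
  ultimately show ?thesis by (simp add: S_def)
qed

text \<open>Triple product with base \<open>y^3\<close> and \<open>z = -(y^2)\<close>. Its factors
  have exponents 6m+5 and 6m+1; the missing odd exponents 6m+3 form \<open>G (y^3)\<close>, so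
  multiplying by it yields the full odd product \<open>G y (3*N)\<close>. The exponent is chosen
  because 3(3n^2 + 2n) + 1 = (3n + 1)^2.\<close>

lemma theta_shifted_third:
  assumes y: "norm y < 1" "y \<noteq> 0"
  shows "((\<lambda>n. (-1) powi n * y powi (3*n^2 + 2*n)) has_sum
     (euler_phi (y^6) * ((euler_phi y / euler_phi (y^2)) / (euler_phi (y^3) / euler_phi (y^6))))) (UNIV :: int set)"
proof -
  have y3: "norm (y^3) < 1" "y^3 \<noteq> 0" and y6: "norm (y^6) < 1"
    using y by (simp_all add: norm_power power_less_one_iff)
  define G where "G = (\<lambda>w::complex. \<lambda>N. \<Prod>m<N. 1 - w ^ (2*m+1))"
  have G_nz: "G (y^3) N \<noteq> 0" for N
    using one_minus_power_nonzero[OF y3(1)] by (auto simp: G_def simp del: power_Suc)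
  have "(\<Prod>m<N. (1 + (y^3) ^ (2*m+1) * (-(y^2))) * (1 + (y^3) ^ (2*m+1) / (-(y^2)))) * G (y^3) N = G y (3*N)" for N
  proof (induction N)
    case (Suc N)
    have p3: "(y^3) ^ (2*N+1) = y ^ (2 * (3*N+1) + 1)"
      unfolding power_mult[symmetric] by (rule arg_cong) simp
    have "y ^ (2 * (3*N+1) + 1) * y^2 = y ^ (2 * (3*N+2) + 1)"
      unfolding power_add[symmetric] by (rule arg_cong) simp
    then have f1: "1 + (y^3) ^ (2*N+1) * (-(y^2)) = 1 - y ^ (2 * (3*N+2) + 1)"
      unfolding p3 by simp
    have "y ^ (2 * (3*N+1) + 1) = y ^ (2 * (3*N) + 1) * y^2"
      unfolding power_add[symmetric] by (rule arg_cong) simp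
    then have f2: "1 + (y^3) ^ (2*N+1) / (-(y^2)) = 1 - y ^ (2 * (3*N) + 1)"
      unfolding p3 using nonzero_mult_div_cancel_right[of "y^2"] y by (simp only: divide_minus_right) auto
    have "(\<Prod>m<Suc N. (1 + (y^3) ^ (2*m+1) * (-(y^2))) * (1 + (y^3) ^ (2*m+1) / (-(y^2)))) * G (y^3) (Suc N)
       = G y (3*N) * (1 - y ^ (2 * (3*N) + 1)) * (1 - y ^ (2 * (3*N+1) + 1)) * (1 - y ^ (2 * (3*N+2) + 1))"
      unfolding Suc[symmetric] unfolding G_def prod.lessThan_Suc f1 f2 unfolding p3 by (simp only: mult_ac)
    moreover have "G y (3 * Suc N)
       = G y (3*N) * (1 - y ^ (2 * (3*N) + 1)) * (1 - y ^ (2 * (3*N+1) + 1)) * (1 - y ^ (2 * (3*N+2) + 1))"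
    proof -
      have "3 * Suc N = Suc (Suc (Suc (3*N)))" by simp
      then show ?thesis
        by (simp only: G_def prod.lessThan_Suc) (simp only: Suc_eq_plus1 add.assoc one_add_one)
    qed
    ultimately show ?case by (simp only:)
  qed (simp add: G_def)
  then have eq: "(\<Prod>m<N. (1 + (y^3) ^ (2*m+1) * (-(y^2))) * (1 + (y^3) ^ (2*m+1) / (-(y^2)))) = G y (3*N) / G (y^3) N" for N
    using G_nz[of N] by (simp add: eq_divide_eq)
  have Glim: "G w \<longlonglongrightarrow> euler_phi w / euler_phi (w^2)" if "norm w < 1" for w
    using prod_odd_minus_LIMSEQ[OF that] by (simp add: G_def)
  have "(\<lambda>N. G y (3*N)) \<longlonglongrightarrow> euler_phi y / euler_phi (y^2)"
    using Glim[OF y(1)] by (rule filterlim_compose) (simp add: mult_nat_left_at_top)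
  then have "(\<lambda>N. \<Prod>m<N. (1 + (y^3) ^ (2*m+1) * (-(y^2))) * (1 + (y^3) ^ (2*m+1) / (-(y^2))))
     \<longlonglongrightarrow> (euler_phi y / euler_phi (y^2)) / (euler_phi (y^3) / euler_phi ((y^3)^2))"
    unfolding eq using euler_phi_nonzero[OF y3(1)] euler_phi_nonzero[OF y6]
    by (intro tendsto_divide Glim y3) (auto simp flip: power_mult)
  from jacobi_triple_product[OF y3 _ this] y(2)
  have "((\<lambda>n. (y^3) powi (n^2) * (-(y^2)) powi n) has_sum (euler_phi (y^6) * ((euler_phi y / euler_phi (y^2)) / (euler_phi (y^3) / euler_phi (y^6))))) UNIV"
    by (simp flip: power_mult)
  moreover have "(y^3) powi (n^2) * (-(y^2)) powi n = (-1) powi n * y powi (3*n^2 + 2*n)" for n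
  proof -
    have "(-(y^2)) powi n = (-1) powi n * y powi (2*n)"
      using power_int_mult_distrib[of "-1" "y^2" n] by (simp add: power_int_power)
    then show ?thesis
      using y(2) by (simp add: power_int_power power_int_add mult_ac)
  qed
  ultimately show ?thesis by simp
qed

text \<open>Triple product at \<open>z = \<omega> * x\<close>. With \<open>y = x^2\<close> the
  factors are \<open>1 + \<omega> * y ^ Suc m\<close> and \<open>1 + \<omega>^2 * y ^ m\<close>, one
  step out of phase. Realigning them (\<open>PK\<close>) costs two boundary factors:
  \<open>1 + \<omega>^2\<close>, which equals \<open>-\<omega>\<close>, and
  \<open>1 + \<omega>^2 * y ^ N\<close>, which tends to 1.\<close>

lemma theta_shifted_half:
  fixes \<omega> :: complex
  assumes y: "norm x < 1" "x \<noteq> 0" and om: "\<omega>^2 + \<omega> + 1 = 0"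
  shows "((\<lambda>n. - (\<omega> powi (n + 2)) * x powi (n^2 + n)) has_sum
     (euler_phi (x^2) * ((euler_phi (x^12) / euler_phi (x^6)) / (euler_phi (x^4) / euler_phi (x^2))))) (UNIV :: int set)"
proof -
  note w = cube_root_unity_facts[OF om]
  define y where "y = x^2"
  have y1: "norm y < 1" "norm (y^2) < 1" "norm (y^3) < 1"
    using y by (simp_all add: y_def norm_power power_less_one_iff)
  define R where "R = (euler_phi ((y^3)^2) / euler_phi (y^3)) / (euler_phi (y^2) / euler_phi y)"
  define P where "P = (\<lambda>N. \<Prod>m<N. (1 + x ^ (2*m+1) * (\<omega> * x)) * (1 + x ^ (2*m+1) / (\<omega> * x)))"
  define K where "K = (\<lambda>N. \<Prod>m<N. (1 + (y^3) ^ Suc m) / (1 + y ^ Suc m))"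
  have P: "P N = (\<Prod>m<N. (1 + \<omega> * y ^ Suc m) * (1 + \<omega>^2 * y ^ m))" for N
  proof -
    have "x ^ (2*m+1) * (\<omega> * x) = \<omega> * y ^ Suc m" for m
      by (simp add: y_def power_mult power2_eq_square)
    moreover have "x ^ (2*m+1) / (\<omega> * x) = (1 / \<omega>) * y ^ m" for m
      using y w(1) by (simp add: y_def power_mult)
    ultimately show ?thesis by (simp only: P_def w(3))
  qed
  have PK: "P N * (1 + \<omega>^2 * y ^ N) = (1 + \<omega>^2) * K N" for N
  proof (induction N)
    case 0
    then show ?case by (simp add: P K_def)
  next
    case (Suc N)
    define t where "t = y ^ Suc N"
    have nz: "1 + t \<noteq> 0" using one_plus_power_nonzero[OF y1(1), of "Suc N"] by (simp only: t_def) auto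
    have t3: "(y^3) ^ Suc N = t^3" by (simp only: t_def mult.commute flip: power_mult)
    have "(1 + \<omega> * t) * (1 + \<omega>^2 * t) * (1 + t) = 1 + t^3"
      using cube_root_unity_factor[OF om, of t]
      by (simp add: mult.commute[of _ t]) (simp add: algebra_simps power2_eq_square power3_eq_cube)
    then have fac: "(1 + t^3) / (1 + t) = (1 + \<omega> * t) * (1 + \<omega>^2 * t)"
      using nz by (simp add: divide_eq_eq)
    have "P (Suc N) = P N * ((1 + \<omega> * t) * (1 + \<omega>^2 * y ^ N))"
      by (simp only: P prod.lessThan_Suc t_def)
    then have "P (Suc N) * (1 + \<omega>^2 * t) = (P N * (1 + \<omega>^2 * y ^ N)) * ((1 + \<omega> * t) * (1 + \<omega>^2 * t))"
      by (simp only: mult_ac)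
    also have "\<dots> = (1 + \<omega>^2) * (K N * ((1 + t^3) / (1 + t)))"
      unfolding Suc fac by (simp only: mult_ac)
    also have "K N * ((1 + t^3) / (1 + t)) = K (Suc N)"
      by (simp only: K_def prod.lessThan_Suc t3 t_def)
    finally show ?case by (simp only: t_def)
  qed
  have "(\<lambda>N. 1 + \<omega>^2 * y ^ N) \<longlonglongrightarrow> 1 + \<omega>^2 * 0"
    using y1 by (intro tendsto_intros LIMSEQ_power_zero)
  then have lim1: "(\<lambda>N. 1 + \<omega>^2 * y ^ N) \<longlonglongrightarrow> 1" by simp
  have ev: "eventually (\<lambda>N. 1 + \<omega>^2 * y ^ N \<noteq> 0) sequentially"
    using lim1 by (rule tendsto_imp_eventually_ne) simp
  have "K \<longlonglongrightarrow> R"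
    unfolding K_def R_def prod_dividef using euler_phi_nonzero[OF y1(1)] euler_phi_nonzero[OF y1(2)]
    by (intro tendsto_divide prod_plus_LIMSEQ y1) auto
  then have "(\<lambda>N. (1 + \<omega>^2) * K N / (1 + \<omega>^2 * y ^ N)) \<longlonglongrightarrow> (1 + \<omega>^2) * R / 1"
    by (intro tendsto_divide tendsto_mult tendsto_const lim1) auto
  moreover have "eventually (\<lambda>N. (1 + \<omega>^2) * K N / (1 + \<omega>^2 * y ^ N) = P N) sequentially"
    using ev by eventually_elim (simp add: divide_eq_eq flip: PK)
  ultimately have "P \<longlonglongrightarrow> (1 + \<omega>^2) * R / 1"
    by (rule Lim_transform_eventually)
  then have "P \<longlonglongrightarrow> - \<omega> * R"
    using w(4) by simp
  then have "((\<lambda>n. x powi (n^2) * (\<omega> * x) powi n) has_sum (euler_phi (x^2) * (- \<omega> * R))) UNIV"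
    using w(1) y unfolding P_def by (intro jacobi_triple_product) auto
  \<comment> \<open>The multiplier \<open>-(\<omega>^2)\<close> cancels the boundary factor
    \<open>-\<omega>\<close>, their product being \<open>\<omega>^3\<close>.\<close>
  note * = has_sum_cmult_right[OF this, of "- (\<omega>^2)"]
  have "((\<lambda>n. - (\<omega>^2) * (x powi (n^2) * (\<omega> * x) powi n)) has_sum (euler_phi (x^2) * R)) UNIV"
  proof -
    have "- (\<omega>^2) * (euler_phi (x^2) * (- \<omega> * R)) = euler_phi (x^2) * R * \<omega>^3"
      by (simp add: power2_eq_square power3_eq_cube mult_ac)
    with * show ?thesis unfolding w(2) by (simp only: mult_1_right mult.assoc)
  qed
  moreover have "- (\<omega>^2) * (x powi (n^2) * (\<omega> * x) powi n) = - (\<omega> powi (n + 2)) * x powi (n^2 + n)" for n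
    using w(1) y by (simp add: power_int_add power_int_mult_distrib mult_ac)
  ultimately show ?thesis
    by (simp add: R_def y_def flip: power_mult)
qed

section \<open>Squared Kronecker symbols and rescaled eta values\<close>

text \<open>The identities contain only squares of the symbols, so each reduces to the indicator of
  coprimality to its modulus.\<close>

lemma kronecker_2_square: "(of_int (kronecker n 2) :: complex) ^ 2 = (if even n then 0 else 1)"
  by (simp add: kronecker_def kronecker_prime_def prime_factorization_prime)

lemma kronecker_3_square: "(of_int (kronecker n 3) :: complex) ^ 2 = (if 3 dvd n then 0 else 1)"
proof -
  have "prime (3::nat)" by simp
  then show ?thesis
    by (simp add: kronecker_def kronecker_prime_def prime_factorization_prime Legendre_def cong_0_iff)
qed

lemma kronecker_6: "kronecker n 6 = kronecker n 2 * kronecker n 3"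
proof -
  have "prime_factorization (2 * 3 :: nat) = prime_factorization 2 + prime_factorization 3"
    by (rule prime_factorization_mult) auto
  then show ?thesis by (simp add: kronecker_def)
qed

lemma kronecker_6_square: "(of_int (kronecker n 6) :: complex) ^ 2 = (if even n \<or> 3 dvd n then 0 else 1)"
  by (simp add: kronecker_6 power_mult_distrib kronecker_2_square kronecker_3_square)

lemmas kronecker_squares = kronecker_2_square kronecker_3_square kronecker_6_square

text \<open>One fixed 24th root of q serves all multiples. Its powers cancel in the two-sided
  identities and leave exactly its 24th power, q, in the one-sided ones.\<close>

lemma dedekind_eta_multiple:
  "dedekind_eta (of_nat k * \<tau>) =
     exp (2 * of_real pi * \<i> * \<tau> / 24) ^ k * euler_phi (exp (2 * of_real pi * \<i> * \<tau>) ^ k)"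
proof -
  have "2 * of_real pi * \<i> * (of_nat k * \<tau>) / 24 = of_nat k * (2 * of_real pi * \<i> * \<tau> / 24)"
    "2 * of_real pi * \<i> * (of_nat k * \<tau>) = of_nat k * (2 * of_real pi * \<i> * \<tau>)"
    by simp_all
  then show ?thesis
    by (simp only: dedekind_eta_def euler_phi_def exp_of_nat_mult)
qed

lemma minus_one_powi_int: "(-1 :: complex) powi n = (if even n then 1 else -1)"
  by (cases "even n") (auto elim!: evenE oddE simp: power_int_add power_int_mult)

theorem theorem2p3:
  fixes \<tau> q :: complex
  assumes "Im \<tau> > 0" and "q = exp (2 * of_real pi * \<i> * \<tau>)"
  shows
    "((\<lambda>n::int. (1 - 2 * of_int (kronecker n 2) ^ 2) * q powi (n ^ 2))
        has_sum (dedekind_eta \<tau> ^ 2 / dedekind_eta (2 * \<tau>))) UNIV \<and>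
     ((\<lambda>n::int. ((-1) powi n) * q powi (n ^ 2))
        has_sum (dedekind_eta \<tau> ^ 2 / dedekind_eta (2 * \<tau>))) UNIV \<and>
     ((\<lambda>n::int. (1 - 3 / 2 * of_int (kronecker n 3) ^ 2) * q powi (n ^ 2))
        has_sum ((dedekind_eta \<tau> * dedekind_eta (4 * \<tau>) * dedekind_eta (6 * \<tau>) ^ 2) / (dedekind_eta (2 * \<tau>) * dedekind_eta (3 * \<tau>) * dedekind_eta (12 * \<tau>)))) UNIV \<and>
     ((\<lambda>n::int. (1 - 2 * of_int (kronecker n 2) ^ 2 - 3 / 2 * of_int (kronecker n 3) ^ 2 + 3 * of_int (kronecker n 6) ^ 2) * q powi (n ^ 2))
        has_sum ((dedekind_eta (2 * \<tau>) ^ 2 * dedekind_eta (3 * \<tau>)) / (dedekind_eta \<tau> * dedekind_eta (6 * \<tau>)))) UNIV \<and>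
     ((\<lambda>n::int. (1 - of_int (kronecker n 2) ^ 2) * q powi (n ^ 2))
        has_sum (dedekind_eta (8 * \<tau>) ^ 5 / (dedekind_eta (4 * \<tau>) ^ 2 * dedekind_eta (16 * \<tau>) ^ 2))) UNIV \<and>
     ((\<lambda>n::int. (1 - 2 * of_int (kronecker n 2) ^ 2 - of_int (kronecker n 3) ^ 2 + 2 * of_int (kronecker n 6) ^ 2) * q powi (n ^ 2))
        has_sum (dedekind_eta (9 * \<tau>) ^ 2 / dedekind_eta (18 * \<tau>))) UNIV \<and>
     ((\<lambda>n::int. (1 - of_int (kronecker n 3) ^ 2) * q powi (n ^ 2))
        has_sum (dedekind_eta (18 * \<tau>) ^ 5 / (dedekind_eta (9 * \<tau>) ^ 2 * dedekind_eta (36 * \<tau>) ^ 2))) UNIV \<and>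
     ((\<lambda>n::int. (1 - of_int (kronecker n 2) ^ 2 - 3 / 2 * of_int (kronecker n 3) ^ 2 + 3 / 2 * of_int (kronecker n 6) ^ 2) * q powi (n ^ 2))
        has_sum ((dedekind_eta (4 * \<tau>) * dedekind_eta (16 * \<tau>) * dedekind_eta (24 * \<tau>) ^ 2) / (dedekind_eta (8 * \<tau>) * dedekind_eta (12 * \<tau>) * dedekind_eta (48 * \<tau>)))) UNIV \<and>
     ((\<lambda>n::int. (1 - of_int (kronecker n 2) ^ 2 - of_int (kronecker n 3) ^ 2 + of_int (kronecker n 6) ^ 2) * q powi (n ^ 2))
        has_sum (dedekind_eta (72 * \<tau>) ^ 5 / (dedekind_eta (36 * \<tau>) ^ 2 * dedekind_eta (144 * \<tau>) ^ 2))) UNIV \<and>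
     ((\<lambda>n::int. (2 * of_int (kronecker n 6) ^ 2 - of_int (kronecker n 3) ^ 2) * q powi (n ^ 2))
        has_sum ((dedekind_eta (3 * \<tau>) * dedekind_eta (18 * \<tau>) ^ 2) / (dedekind_eta (6 * \<tau>) * dedekind_eta (9 * \<tau>)))) {1..} \<and>
     ((\<lambda>n::int. (3 * of_int (kronecker n 6) ^ 2 - 2 * of_int (kronecker n 2) ^ 2) * q powi (n ^ 2))
        has_sum ((dedekind_eta (8 * \<tau>) ^ 2 * dedekind_eta (48 * \<tau>)) / (dedekind_eta (16 * \<tau>) * dedekind_eta (24 * \<tau>)))) {1..}"
    (is "?I1 \<and> ?I1' \<and> ?I2 \<and> ?I3 \<and> ?I4 \<and> ?I5 \<and> ?I6 \<and> ?I7 \<and> ?I8 \<and> ?I9 \<and> ?I10")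
proof -
  have q: "norm q < 1" "q \<noteq> 0"
    using assms by (simp_all add: mult_pos_pos)
  have qk: "norm (q ^ k) < 1" "q ^ k \<noteq> 0" if "k > 0" for k
    using q that by (simp_all add: norm_power power_less_one_iff)
  define e where "e = exp (2 * of_real pi * \<i> * \<tau> / 24)"
  have e: "e \<noteq> 0" by (simp add: e_def)
  have e24: "q = e ^ 24"
    using exp_of_nat_mult[of 24 "2 * of_real pi * \<i> * \<tau> / 24"] by (simp add: e_def assms(2) mult_ac)
  define F where "F = (\<lambda>k. euler_phi (q ^ k))"
  have F: "F k \<noteq> 0" if "k > 0" for k
    unfolding F_def by (rule euler_phi_nonzero[OF qk(1)[OF that]])
  have F_power: "euler_phi (q ^ k) = F k" for k by (simp add: F_def)
  have eta: "dedekind_eta (numeral k * \<tau>) = e ^ numeral k * F (numeral k)" for k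
    using dedekind_eta_multiple[of "numeral k" \<tau>] by (simp add: F_def e_def assms(2))
  have eta1: "dedekind_eta \<tau> = e * F 1"
    using dedekind_eta_multiple[of 1 \<tau>] by (simp add: F_def e_def assms(2))
  have H: "odd_plus_prod (q ^ k) = F (2 * k) ^ 2 / (F k * F (4 * k))" for k
    by (simp add: odd_plus_prod_def F_def mult.commute flip: power_mult)
  have powi_q: "(q ^ k) powi m = q powi (int k * m)" for k m
    by (rule power_int_power)

  \<comment> \<open>Three theta families on multiples of \<open>k\<close> as eta quotients\<close>
  have plus: "((\<lambda>n. q powi ((int k * n) ^ 2)) has_sum
      (dedekind_eta (of_nat (2 * k^2) * \<tau>) ^ 5 /
        (dedekind_eta (of_nat (k^2) * \<tau>) ^ 2 * dedekind_eta (of_nat (4 * k^2) * \<tau>) ^ 2))) UNIV"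
    if k: "k > 0" for k
  proof -
    \<comment> \<open>Passing from q to \<open>q ^ (k^2)\<close> in the theta series turns the
      squares of all integers into the squares of multiples of \<open>k\<close>.\<close>
    have "((\<lambda>n. q powi ((int k * n) ^ 2)) has_sum (F (2*k^2) * (F (2 * k^2) ^ 2 / (F (k^2) * F (4 * k^2)))^2)) UNIV"
      using theta_plus[OF qk, of "k^2"] k
      by (simp add: F_power H powi_q power_mult_distrib mult.commute flip: power_mult)
    also have "F (2*k^2) * (F (2 * k^2) ^ 2 / (F (k^2) * F (4 * k^2)))^2 =
       dedekind_eta (of_nat (2 * k^2) * \<tau>) ^ 5 /
        (dedekind_eta (of_nat (k^2) * \<tau>) ^ 2 * dedekind_eta (of_nat (4 * k^2) * \<tau>) ^ 2)"
    proof -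
      have "(e ^ (2 * m) * x)^5 / ((e ^ m * y)^2 * (e ^ (4 * m) * z)^2) = x * (x^2 / (y * z))^2"
        if "y \<noteq> 0" "z \<noteq> 0" for m x y z
      proof -
        have "(e ^ (2 * m))^5 = (e ^ m)^2 * (e ^ (4 * m))^2"
          by (simp flip: power_mult power_add)
        then show ?thesis using that e
          by (simp add: power_mult_distrib power_divide field_simps flip: power_mult power_Suc)
      qed
      then show ?thesis
        unfolding dedekind_eta_multiple e_def[symmetric] assms(2)[symmetric] F_power
        using k F by simp
    qed
    finally show ?thesis .
  qed

  have minus: "((\<lambda>n. (-1) powi n * q powi ((int k * n) ^ 2)) has_sum
      (dedekind_eta (of_nat (k^2) * \<tau>) ^ 2 / dedekind_eta (of_nat (2 * k^2) * \<tau>))) UNIV"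
    if k: "k > 0" for k
  proof -
    have "((\<lambda>n. (-1) powi n * q powi ((int k * n) ^ 2)) has_sum (F (k^2) ^ 2 / F (2 * k^2))) UNIV"
      using theta_minus[OF qk, of "k^2"] k
      by (simp add: F_power powi_q power_mult_distrib mult.commute flip: power_mult)
    also have "F (k^2) ^ 2 / F (2 * k^2) =
       dedekind_eta (of_nat (k^2) * \<tau>) ^ 2 / dedekind_eta (of_nat (2 * k^2) * \<tau>)"
    proof -
      have "(e ^ m * x) ^ 2 / (e ^ (2 * m) * y) = x ^ 2 / y" for m x y
        using e by (simp add: power_mult_distrib mult.commute flip: power_mult)
      then show ?thesis
        unfolding dedekind_eta_multiple e_def[symmetric] assms(2)[symmetric] F_power by simp
    qed
    finally show ?thesis .
  qed

  have cubic: "((\<lambda>n. (if 3 dvd n then 1 else -1/2) * q powi ((int k * n) ^ 2)) has_sum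
      (dedekind_eta (of_nat (k^2) * \<tau>) * dedekind_eta (of_nat (4*k^2) * \<tau>) * dedekind_eta (of_nat (6*k^2) * \<tau>) ^ 2
       / (dedekind_eta (of_nat (2*k^2) * \<tau>) * dedekind_eta (of_nat (3*k^2) * \<tau>) * dedekind_eta (of_nat (12*k^2) * \<tau>)))) UNIV"
    if k: "k > 0" for k
  proof -
    have "((\<lambda>n. (if 3 dvd n then 1 else -1/2) * q powi ((int k * n) ^ 2)) has_sum
        (F (2*k^2) * ((F (6*k^2) ^ 2 / (F (3*k^2) * F (12*k^2))) / (F (2*k^2) ^ 2 / (F (k^2) * F (4*k^2)))))) UNIV"
      using theta_cubic[OF qk, of "k^2"] k
      by (simp add: F_power H powi_q power_mult_distrib mult.commute flip: power_mult)
    also have "F (2*k^2) * ((F (6*k^2) ^ 2 / (F (3*k^2) * F (12*k^2))) / (F (2*k^2) ^ 2 / (F (k^2) * F (4*k^2)))) =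
       dedekind_eta (of_nat (k^2) * \<tau>) * dedekind_eta (of_nat (4*k^2) * \<tau>) * dedekind_eta (of_nat (6*k^2) * \<tau>) ^ 2
       / (dedekind_eta (of_nat (2*k^2) * \<tau>) * dedekind_eta (of_nat (3*k^2) * \<tau>) * dedekind_eta (of_nat (12*k^2) * \<tau>))"
    proof -
      have "(e ^ m * x1) * (e ^ (4*m) * x4) * (e ^ (6*m) * x6)^2 / ((e ^ (2*m) * x2) * (e ^ (3*m) * x3) * (e ^ (12*m) * x12))
          = x2 * ((x6^2 / (x3 * x12)) / (x2^2 / (x1 * x4)))"
        if "x2 \<noteq> 0" for m x1 x2 x3 x4 x6 x12
      proof -
        \<comment> \<open>Weights balance: 1 + 4 + 12 = 2 + 3 + 12.\<close>
        have "e ^ m * e ^ (4*m) * (e ^ (6*m))^2 = e ^ (2*m) * e ^ (3*m) * e ^ (12*m)"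
          by (simp flip: power_mult power_add)
        then have "(e ^ m * x1) * (e ^ (4*m) * x4) * (e ^ (6*m) * x6)^2
          = e ^ (2*m) * e ^ (3*m) * e ^ (12*m) * (x1 * x4 * x6^2)"
          by (simp add: power_mult_distrib mult_ac)
        moreover have "(e ^ (2*m) * x2) * (e ^ (3*m) * x3) * (e ^ (12*m) * x12)
          = e ^ (2*m) * e ^ (3*m) * e ^ (12*m) * (x2 * x3 * x12)"
          by (simp add: mult_ac)
        moreover have "e ^ (2*m) * e ^ (3*m) * e ^ (12*m) \<noteq> 0" using e by simp
        note mult_divide_mult_cancel_left[OF this, of "x1 * x4 * x6^2" "x2 * x3 * x12"]
        ultimately have "(e ^ m * x1) * (e ^ (4*m) * x4) * (e ^ (6*m) * x6)^2 / ((e ^ (2*m) * x2) * (e ^ (3*m) * x3) * (e ^ (12*m) * x12))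
          = (x1 * x4 * x6^2) / (x2 * x3 * x12)"
          by (simp only:)
        then show ?thesis
          using that by (simp add: power2_eq_square mult_ac)
      qed
      then show ?thesis
        unfolding dedekind_eta_multiple e_def[symmetric] assms(2)[symmetric] F_power
        using k F by simp
    qed
    finally show ?thesis .
  qed

  \<comment> \<open>Two-sided identities\<close>
  have i1: ?I1'
    using minus[of 1] by simp
  have i1b: ?I1
    using i1 by (simp add: kronecker_squares minus_one_powi_int if_distrib cong: if_cong)
  have i2: ?I2
  proof -
    have "(1 - 3 / 2 * of_int (kronecker n 3) ^ 2) = (if 3 dvd n then 1 else -1/2 :: complex)" for n
      by (simp add: kronecker_squares)
    then show ?thesis using cubic[of 1] by simp
  qed
  have i3: ?I3
  proof -
    have "F 2 * ((F 3 / F 6) / (F 1 / F 2)) = (dedekind_eta (2 * \<tau>) ^ 2 * dedekind_eta (3 * \<tau>)) / (dedekind_eta \<tau> * dedekind_eta (6 * \<tau>))"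
      unfolding eta eta1 using e F by (simp add: field_simps power2_eq_square power_numeral_reduce)
    \<comment> \<open>As (n/6)^2 = (n/2)^2 (n/3)^2, the coefficient factors as (1 - 2(n/2)^2)(1 -
      (3/2)(n/3)^2), that is, the sign times the cubic coefficient.\<close>
    moreover have "(1 - 2 * of_int (kronecker n 2) ^ 2 - 3 / 2 * of_int (kronecker n 3) ^ 2 + 3 * of_int (kronecker n 6) ^ 2)
       = ((-1) powi n * (if 3 dvd n then 1 else -1/2) :: complex)" for n
      by (simp add: kronecker_squares minus_one_powi_int)
    ultimately show ?thesis
      using theta_cubic_alternating[OF q] by (simp add: F_def)
  qed
  have i4: ?I4
  proof (rule has_sum_affine_support[where k = 2 and r = 0])
    show "((\<lambda>n. (1 - of_int (kronecker (2 * n + 0) 2) ^ 2) * q powi ((2 * n + 0) ^ 2))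
        has_sum (dedekind_eta (8 * \<tau>) ^ 5 / (dedekind_eta (4 * \<tau>) ^ 2 * dedekind_eta (16 * \<tau>) ^ 2))) UNIV"
      using plus[of 2] by (simp add: kronecker_squares)
  qed (auto simp: kronecker_squares)
  have i5: ?I5
  proof (rule has_sum_affine_support[where k = 3 and r = 0])
    \<comment> \<open>The coefficient is (1 - (n/3)^2)(1 - 2(n/2)^2): the first factor confines the
      sum to multiples of 3, where the second is the sign.\<close>
    have "1 - 2 * of_int (kronecker (3*n) 2) ^ 2 - of_int (kronecker (3*n) 3) ^ 2 + 2 * of_int (kronecker (3*n) 6) ^ 2
       = ((-1) powi n :: complex)" for n
      by (simp add: kronecker_squares minus_one_powi_int)
    then show "((\<lambda>n. (1 - 2 * of_int (kronecker (3 * n + 0) 2) ^ 2 - of_int (kronecker (3 * n + 0) 3) ^ 2 + 2 * of_int (kronecker (3 * n + 0) 6) ^ 2) * q powi ((3 * n + 0) ^ 2))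
        has_sum (dedekind_eta (9 * \<tau>) ^ 2 / dedekind_eta (18 * \<tau>))) UNIV"
      using minus[of 3] by simp
  qed (auto simp: kronecker_squares)
  have i6: ?I6
  proof (rule has_sum_affine_support[where k = 3 and r = 0])
    show "((\<lambda>n. (1 - of_int (kronecker (3 * n + 0) 3) ^ 2) * q powi ((3 * n + 0) ^ 2))
        has_sum (dedekind_eta (18 * \<tau>) ^ 5 / (dedekind_eta (9 * \<tau>) ^ 2 * dedekind_eta (36 * \<tau>) ^ 2))) UNIV"
      using plus[of 3] by (simp add: kronecker_squares)
  qed (auto simp: kronecker_squares)
  have i7: ?I7
  proof (rule has_sum_affine_support[where k = 2 and r = 0])
    \<comment> \<open>On even indices the coefficient is the cubic one, and doubling the index
      preserves it since 2 is invertible modulo 3.\<close>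
    have "3 dvd 2 * n \<longleftrightarrow> 3 dvd n" for n :: int by presburger
    then have "1 - of_int (kronecker (2*n) 2) ^ 2 - 3 / 2 * of_int (kronecker (2*n) 3) ^ 2 + 3 / 2 * of_int (kronecker (2*n) 6) ^ 2
       = (if 3 dvd n then 1 else -1/2 :: complex)" for n
      by (simp add: kronecker_squares)
    then show "((\<lambda>n. (1 - of_int (kronecker (2 * n + 0) 2) ^ 2 - 3 / 2 * of_int (kronecker (2 * n + 0) 3) ^ 2 + 3 / 2 * of_int (kronecker (2 * n + 0) 6) ^ 2) * q powi ((2 * n + 0) ^ 2))
        has_sum ((dedekind_eta (4 * \<tau>) * dedekind_eta (16 * \<tau>) * dedekind_eta (24 * \<tau>) ^ 2) / (dedekind_eta (8 * \<tau>) * dedekind_eta (12 * \<tau>) * dedekind_eta (48 * \<tau>)))) UNIV"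
      using cubic[of 2] by simp
  qed (auto simp: kronecker_squares)
  have i8: ?I8
  proof (rule has_sum_affine_support[where k = 6 and r = 0])
    have "even (6 * n)" "3 dvd 6 * n" for n :: int by presburger+
    then show "((\<lambda>n. (1 - of_int (kronecker (6 * n + 0) 2) ^ 2 - of_int (kronecker (6 * n + 0) 3) ^ 2 + of_int (kronecker (6 * n + 0) 6) ^ 2) * q powi ((6 * n + 0) ^ 2))
        has_sum (dedekind_eta (72 * \<tau>) ^ 5 / (dedekind_eta (36 * \<tau>) ^ 2 * dedekind_eta (144 * \<tau>) ^ 2))) UNIV"
      using plus[of 6] by (simp add: kronecker_squares)
  next
    fix n :: int
    assume "\<not> 6 dvd n - 0"
    then have "\<not> (even n \<and> 3 dvd n)" by presburger
    then show "(1 - of_int (kronecker n 2) ^ 2 - of_int (kronecker n 3) ^ 2 + of_int (kronecker n 6) ^ 2) * q powi (n ^ 2) = 0"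
      by (auto simp: kronecker_squares)
  qed simp

  \<comment> \<open>One-sided identities\<close>
  have i9: ?I9
  proof -
    \<comment> \<open>Only the class of 1 modulo 3 is kept; folding brings in the class of -1, so
      each positive \<open>n\<close> prime to 3 receives exactly one term, with sign 1 for odd and
      -1 for even \<open>n\<close>.\<close>
    define f where "f = (\<lambda>n::int. if 3 dvd n - 1 then - ((-1) powi n) * q powi (n^2) else 0)"
    define S where "S = q * (F 18 * ((F 3 / F 6) / (F 9 / F 18)))"
    have "(f has_sum S) UNIV"
    proof (rule has_sum_affine_support[where k = 3 and r = 1])
      have "((\<lambda>n. (-1) powi n * q powi (3 * (3 * n^2 + 2 * n))) has_sum (F 18 * ((F 3 / F 6) / (F 9 / F 18)))) UNIV"
        using theta_shifted_third[OF qk, of 3] by (simp add: F_power powi_q flip: power_mult)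
      from has_sum_cmult_right[OF this, of q]
      have "((\<lambda>n. q * ((-1) powi n * q powi (3 * (3 * n^2 + 2 * n)))) has_sum S) UNIV"
        by (simp add: S_def)
      moreover have "q * ((-1) powi n * q powi (3 * (3 * n^2 + 2 * n))) = f (3 * n + 1)" for n
      proof -
        have "(3 * n + 1)^2 = 3 * (3 * n^2 + 2 * n) + 1"
          by (simp add: power2_eq_square algebra_simps)
        then have "q powi ((3 * n + 1)^2) = q powi (3 * (3 * n^2 + 2 * n)) * q"
          using q by (simp only: power_int_add_1 simp_thms)
        then show ?thesis by (simp add: f_def minus_one_powi_int)
      qed
      ultimately show "((\<lambda>n. f (3 * n + 1)) has_sum S) UNIV" by simp
    qed (auto simp: f_def)
    then have "((\<lambda>n. f n + f (-n)) has_sum S) {1..}"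
      by (rule has_sum_symmetrize_positive) (simp add: f_def)
    moreover have "f n + f (-n) = (2 * of_int (kronecker n 6) ^ 2 - of_int (kronecker n 3) ^ 2) * q powi (n ^ 2)" for n
    proof -
      have "3 dvd n \<and> \<not> 3 dvd n - 1 \<and> \<not> 3 dvd - n - 1
        \<or> \<not> 3 dvd n \<and> 3 dvd n - 1 \<and> \<not> 3 dvd - n - 1
        \<or> \<not> 3 dvd n \<and> \<not> 3 dvd n - 1 \<and> 3 dvd - n - 1"
        by presburger
      then consider "3 dvd n" "\<not> 3 dvd n - 1" "\<not> 3 dvd - n - 1"
        | "\<not> 3 dvd n" "3 dvd n - 1" "\<not> 3 dvd - n - 1"
        | "\<not> 3 dvd n" "\<not> 3 dvd n - 1" "3 dvd - n - 1"
        by blast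
      then show ?thesis
        by cases (simp_all add: f_def kronecker_squares minus_one_powi_int)
    qed
    moreover have "S = (dedekind_eta (3 * \<tau>) * dedekind_eta (18 * \<tau>) ^ 2) / (dedekind_eta (6 * \<tau>) * dedekind_eta (9 * \<tau>))"
    proof -
      \<comment> \<open>Weights: 3 + 36 = 6 + 9 + 24, and the surplus \<open>e ^ 24\<close> is the
        prefactor \<open>q\<close> of \<open>S\<close>.\<close>
      have num: "e ^ 3 * F 3 * (e ^ 18 * F 18) ^ 2 = (e ^ 6 * e ^ 9) * (e ^ 24 * (F 3 * F 18 ^ 2))"
      proof -
        have "e ^ 3 * F 3 * (e ^ 18 * F 18) ^ 2 = (e ^ 3 * (e ^ 18) ^ 2) * (F 3 * F 18 ^ 2)"
          by (simp only: power_mult_distrib mult_ac)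
        also have "e ^ 3 * (e ^ 18) ^ 2 = (e ^ 6 * e ^ 9) * e ^ 24"
          by (simp flip: power_mult power_add)
        finally show ?thesis by (simp only: mult.assoc)
      qed
      have den: "e ^ 6 * F 6 * (e ^ 9 * F 9) = (e ^ 6 * e ^ 9) * (F 6 * F 9)"
        by (simp only: mult_ac)
      have nz: "e ^ 6 * e ^ 9 \<noteq> 0" using e by simp
      show ?thesis
        unfolding S_def eta num den unfolding mult_divide_mult_cancel_left[OF nz] unfolding e24[symmetric]
        by (simp add: power2_eq_square mult_ac)
    qed
    ultimately show ?thesis by simp
  qed
  have i10: ?I10
  proof -
    obtain \<omega> :: complex where om: "\<omega>^2 + \<omega> + 1 = 0" using cube_root_unity_exists by blast
    \<comment> \<open>At index 2k + 1 the exponent \<open>2 * n\<close> is 4k + 2, congruent to k +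
      2 modulo 3 as in \<open>theta_shifted_half\<close>. Being odd in \<open>n\<close>, it makes
      the folded coefficient minus the sum of inverse powers of \<open>\<omega>\<close>: -2 if 3
      divides \<open>n\<close>, else 1.\<close>
    define f where "f = (\<lambda>n::int. if 2 dvd n - 1 then - (\<omega> powi (2 * n)) * q powi (n^2) else 0)"
    define S where "S = q * (F 8 * ((F 48 / F 24) / (F 16 / F 8)))"
    have "(f has_sum S) UNIV"
    proof (rule has_sum_affine_support[where k = 2 and r = 1])
      have "((\<lambda>n. - (\<omega> powi (n + 2)) * q powi (4 * (n^2 + n))) has_sum (F 8 * ((F 48 / F 24) / (F 16 / F 8)))) UNIV"
        using theta_shifted_half[OF qk om, of 4] by (simp add: F_power powi_q flip: power_mult)
      from has_sum_cmult_right[OF this, of q]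
      have "((\<lambda>n. q * (- (\<omega> powi (n + 2)) * q powi (4 * (n^2 + n)))) has_sum S) UNIV"
        by (simp add: S_def)
      moreover have "q * (- (\<omega> powi (n + 2)) * q powi (4 * (n^2 + n))) = f (2 * n + 1)" for n
      proof -
        have "(2 * n + 1)^2 = 4 * (n^2 + n) + 1"
          by (simp add: power2_eq_square algebra_simps)
        then have q': "q powi ((2 * n + 1)^2) = q powi (4 * (n^2 + n)) * q"
          using q by (simp only: power_int_add_1 simp_thms)
        have "2 * (2 * n + 1) = 3 * n + (n + 2)" by simp
        then have "\<omega> powi (2 * (2 * n + 1)) = \<omega> powi (3 * n) * \<omega> powi (n + 2)"
          using cube_root_unity_facts(1)[OF om] by (simp only: power_int_add simp_thms)
        also have "\<omega> powi (3 * n) = 1"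
          using cube_root_unity_facts(2)[OF om] by (simp add: power_int_mult)
        finally have "f (2 * n + 1) = - (\<omega> powi (n + 2)) * (q powi (4 * (n^2 + n)) * q)"
          unfolding f_def q' by simp
        then show ?thesis by (simp only: mult_ac)
      qed
      ultimately show "((\<lambda>n. f (2 * n + 1)) has_sum S) UNIV" by simp
    qed (auto simp: f_def)
    then have "((\<lambda>n. f n + f (-n)) has_sum S) {1..}"
      by (rule has_sum_symmetrize_positive) (simp add: f_def)
    moreover have "f n + f (-n) = (3 * of_int (kronecker n 6) ^ 2 - 2 * of_int (kronecker n 2) ^ 2) * q powi (n ^ 2)" for n
    proof (cases "even n")
      case True
      then show ?thesis by (simp add: f_def kronecker_squares)
    next
      case False
      then have "f n + f (-n) = - (\<omega> powi (2 * n) + \<omega> powi (- (2 * n))) * q powi (n^2)"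
        by (simp add: f_def algebra_simps)
      moreover have "3 dvd 2 * n \<longleftrightarrow> 3 dvd n" by presburger
      ultimately show ?thesis
        using False by (simp add: cube_root_unity_powi_sum[OF om] kronecker_squares)
    qed
    moreover have "S = (dedekind_eta (8 * \<tau>) ^ 2 * dedekind_eta (48 * \<tau>)) / (dedekind_eta (16 * \<tau>) * dedekind_eta (24 * \<tau>))"
    proof -
      have num: "(e ^ 8 * F 8) ^ 2 * (e ^ 48 * F 48) = (e ^ 16 * e ^ 24) * (e ^ 24 * (F 8 ^ 2 * F 48))"
      proof -
        have "(e ^ 8 * F 8) ^ 2 * (e ^ 48 * F 48) = ((e ^ 8) ^ 2 * e ^ 48) * (F 8 ^ 2 * F 48)"
          by (simp only: power_mult_distrib mult_ac)
        also have "(e ^ 8) ^ 2 * e ^ 48 = (e ^ 16 * e ^ 24) * e ^ 24"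
          by (simp flip: power_mult power_add)
        finally show ?thesis by (simp only: mult.assoc)
      qed
      have den: "e ^ 16 * F 16 * (e ^ 24 * F 24) = (e ^ 16 * e ^ 24) * (F 16 * F 24)"
        by (simp only: mult_ac)
      have nz: "e ^ 16 * e ^ 24 \<noteq> 0" using e by simp
      show ?thesis
        unfolding S_def eta num den unfolding mult_divide_mult_cancel_left[OF nz] unfolding e24[symmetric]
        by (simp add: power2_eq_square mult_ac)
    qed
    ultimately show ?thesis by simp
  qed
  show ?thesis
    using i1 i1b i2 i3 i4 i5 i6 i7 i8 i9 i10 by blast
qed

end
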